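(* For any LTL formula $\varphi$ (in negation normal form) that does not contain any subformula of the form $\mathbf{X}(\chi \mathbin{\mathbf{U}} \chi')$, the automaton $\mathcal{A}_\varphi$ is a simple linear weak alternating automaton.
   Context: Fix a finite set $\mathcal{V}$ of atomic propositions. LTL formulas in negation normal form are built from literals ($v$ or $\lnot v$ for $v \in \mathcal{V}$) using $\land$, $\lor$, $\mathbf{X}$ (next), $\mathbf{U}$ (until) and $\mathbf{V}$ (release). A set $S$ of propositions/locations is identified with the Boolean valuation making exactly its elements true; "$S \models \theta$" means this valuation satisfies the propositional formula $\theta$. An alternating $\omega$-automaton is $(Q, q_0, \delta, Acc)$ with $Q$ a finite set of locations disjoint from $\mathcal{V}$, $q_0 \in Q$, $\delta$ assigning to each $q \in Q$ a propositional formula $\delta(q)$ over $Q \cup \mathcal{V}$ in which locations occur only positively, and $Acc \subseteq Q^\omega$. Write $q \to q'$ if $q'$ occurs in $\delta(q)$. A (co-Büchi) linear weak alternating automaton (LWAA) is $(Q, q_0, \delta, F)$ with $F \subseteq Q$ such that the relation $q' \preceq q$ iff $q \to^* q'$ is a partial order on $Q$ (acceptance: a path is accepting iff it visits $F$ only finitely often). An LWAA $(Q, q_0, \delta, F)$ is simple if for all $q \in F$, all $q' \in Q$, all states $s \subseteq \mathcal{V}$, and all $X, Y \subseteq Q$ with $q \notin X$, $q \notin Y$: if $s \cup X \cup \{q\} \models \delta(q')$ and $s \cup Y \models \delta(q)$, then $s \cup X \cup Y \models \delta(q')$. For an LTL formula $\varphi$ in negation normal form, $\mathcal{A}_\varphi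 = (Q, q_\varphi, \delta, F)$ where $Q$ contains one location $q_\psi$ for every subformula $\psi$ of $\varphi$, the initial location is $q_\varphi$, $F = \{q_{\psi \mathbin{\mathbf{U}} \chi} \in Q\}$ (locations of until-subformulas), and $\delta$ is defined by: $\delta(q_\psi) = \psi$ for a literal $\psi$; $\delta(q_{\psi\land\chi}) = \delta(q_\psi) \land \delta(q_\chi)$; $\delta(q_{\psi\lor\chi}) = \delta(q_\psi) \lor \delta(q_\chi)$; $\delta(q_{\mathbf{X}\psi}) = q_\psi$; $\delta(q_{\psi \mathbin{\mathbf{U}} \chi}) = \delta(q_\chi) \lor (\delta(q_\psi) \land q_{\psi \mathbin{\mathbf{U}} \chi})$; $\delta(q_{\psi \mathbin{\mathbf{V}} \chi}) = \delta(q_\chi) \land (\delta(q_\psi) \lor q_{\psi \mathbin{\mathbf{V}} \chi})$. *)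

theory Defs
  imports Main
begin

section \<open>Propositional formulas\<close>

datatype 'a pform =
    PTrue
  | PFalse
  | PAtom 'a
  | PNot "'a pform"
  | PAnd "'a pform" "'a pform"
  | POr "'a pform" "'a pform"

primrec satisfies :: "'a set \<Rightarrow> 'a pform \<Rightarrow> bool" (infix "\<Turnstile>" 50) where
  "S \<Turnstile> PTrue \<longleftrightarrow> True"
| "S \<Turnstile> PFalse \<longleftrightarrow> False"
| "S \<Turnstile> PAtom a \<longleftrightarrow> a \<in> S"
| "S \<Turnstile> PNot f \<longleftrightarrow> \<not> S \<Turnstile> f"
| "S \<Turnstile> PAnd f g \<longleftrightarrow> S \<Turnstile> f \<and> S \<Turnstile> g"
| "S \<Turnstile> POr f g \<longleftrightarrow> S \<Turnstile> f \<or> S \<Turnstile> g"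

text \<open>\<open>occurrences True f\<close> and \<open>occurrences False f\<close> are the atoms with a positive (under an
  even number of negations) and with a negative occurrence in \<open>f\<close>, respectively.\<close>

primrec occurrences :: "bool \<Rightarrow> 'a pform \<Rightarrow> 'a set" where
  "occurrences p PTrue = {}"
| "occurrences p PFalse = {}"
| "occurrences p (PAtom a) = (if p then {a} else {})"
| "occurrences p (PNot f) = occurrences (\<not> p) f"
| "occurrences p (PAnd f g) = occurrences p f \<union> occurrences p g"
| "occurrences p (POr f g) = occurrences p f \<union> occurrences p g"


section \<open>Alternating automata\<close>

text \<open>Transition formulas range over the disjoint sum of locations (\<open>Inl\<close>) and atomic
  propositions (\<open>Inr\<close>), which makes the two sets of atoms disjoint by construction. The
  valuation given by a state \<open>s\<close> together with a set \<open>X\<close> of locations is \<open>X <+> s\<close>.\<close>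

record ('q, 'v) alt_structure =
  locs :: "'q set"
  init :: "'q"
  delta :: "'q \<Rightarrow> ('q + 'v) pform"

record ('q, 'v) alt_automaton = "('q, 'v) alt_structure" +
  acc :: "(nat \<Rightarrow> 'q) set"

record ('q, 'v) cobuchi_automaton = "('q, 'v) alt_structure" +
  final :: "'q set"

definition alternating_automaton :: "'v set \<Rightarrow> ('q, 'v) alt_automaton \<Rightarrow> bool" where
  "alternating_automaton V A \<longleftrightarrow>
     finite (locs A) \<and>
     init A \<in> locs A \<and>
     (\<forall>q\<in>locs A. set_pform (delta A q) \<subseteq> locs A <+> V) \<and>
     (\<forall>q\<in>locs A. \<forall>q'. Inl q' \<notin> occurrences False (delta A q)) \<and>
     acc A \<subseteq> {\<rho>. range \<rho> \<subseteq> locs A}"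

text \<open>The co-Buechi condition: a path is accepting iff it visits the final locations only
  finitely often.\<close>

definition to_alt :: "('q, 'v) cobuchi_automaton \<Rightarrow> ('q, 'v) alt_automaton" where
  "to_alt A = \<lparr> locs = locs A, init = init A, delta = delta A,
     acc = {\<rho>. range \<rho> \<subseteq> locs A \<and> finite {i. \<rho> i \<in> final A}} \<rparr>"

definition edges :: "('q, 'v, 'z) alt_structure_scheme \<Rightarrow> 'q rel" where
  "edges A = {(q, q'). q \<in> locs A \<and> Inl q' \<in> set_pform (delta A q)}"

definition loc_order :: "('q, 'v, 'z) alt_structure_scheme \<Rightarrow> 'q rel" where
  "loc_order A = {(q', q). q' \<in> locs A \<and> q \<in> locs A \<and> (q, q') \<in> (edges A)\<^sup>*}"

definition lwaa :: "'v set \<Rightarrow> ('q, 'v) cobuchi_automaton \<Rightarrow> bool" where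
  "lwaa V A \<longleftrightarrow>
     alternating_automaton V (to_alt A) \<and>
     final A \<subseteq> locs A \<and>
     partial_order_on (locs A) (loc_order A)"

definition simple_lwaa :: "'v set \<Rightarrow> ('q, 'v) cobuchi_automaton \<Rightarrow> bool" where
  "simple_lwaa V A \<longleftrightarrow>
     lwaa V A \<and>
     (\<forall>q\<in>final A. \<forall>q'\<in>locs A. \<forall>s X Y.
        s \<subseteq> V \<longrightarrow> X \<subseteq> locs A \<longrightarrow> Y \<subseteq> locs A \<longrightarrow> q \<notin> X \<longrightarrow> q \<notin> Y \<longrightarrow>
        (X \<union> {q}) <+> s \<Turnstile> delta A q' \<longrightarrow>
        Y <+> s \<Turnstile> delta A q \<longrightarrow>
        (X \<union> Y) <+> s \<Turnstile> delta A q')"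


section \<open>LTL in negation normal form and the associated automaton\<close>

datatype (ltl_atoms: 'v) ltl =
    Prop 'v
  | NProp 'v
  | And "'v ltl" "'v ltl"
  | Or "'v ltl" "'v ltl"
  | Next "'v ltl"
  | Until "'v ltl" "'v ltl"
  | Release "'v ltl" "'v ltl"

primrec subformulas :: "'v ltl \<Rightarrow> 'v ltl set" where
  "subformulas (Prop v) = {Prop v}"
| "subformulas (NProp v) = {NProp v}"
| "subformulas (And \<psi> \<chi>) = {And \<psi> \<chi>} \<union> subformulas \<psi> \<union> subformulas \<chi>"
| "subformulas (Or \<psi> \<chi>) = {Or \<psi> \<chi>} \<union> subformulas \<psi> \<union> subformulas \<chi>"
| "subformulas (Next \<psi>) = {Next \<psi>} \<union> subformulas \<psi>"
| "subformulas (Until \<psi> \<chi>) = {Until \<psi> \<chi>} \<union> subformulas \<psi> \<union> subformulas \<chi>"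
| "subformulas (Release \<psi> \<chi>) = {Release \<psi> \<chi>} \<union> subformulas \<psi> \<union> subformulas \<chi>"

text \<open>The location of a subformula is the subformula itself.\<close>

primrec ltl_delta :: "'v ltl \<Rightarrow> ('v ltl + 'v) pform" where
  "ltl_delta (Prop v) = PAtom (Inr v)"
| "ltl_delta (NProp v) = PNot (PAtom (Inr v))"
| "ltl_delta (And \<psi> \<chi>) = PAnd (ltl_delta \<psi>) (ltl_delta \<chi>)"
| "ltl_delta (Or \<psi> \<chi>) = POr (ltl_delta \<psi>) (ltl_delta \<chi>)"
| "ltl_delta (Next \<psi>) = PAtom (Inl \<psi>)"
| "ltl_delta (Until \<psi> \<chi>) =
     POr (ltl_delta \<chi>) (PAnd (ltl_delta \<psi>) (PAtom (Inl (Until \<psi> \<chi>))))"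
| "ltl_delta (Release \<psi> \<chi>) =
     PAnd (ltl_delta \<chi>) (POr (ltl_delta \<psi>) (PAtom (Inl (Release \<psi> \<chi>))))"

definition ltl_automaton :: "'v ltl \<Rightarrow> ('v ltl, 'v) cobuchi_automaton" where
  "ltl_automaton \<phi> = \<lparr> locs = subformulas \<phi>, init = \<phi>, delta = ltl_delta,
     final = {Until \<psi> \<chi> | \<psi> \<chi>. Until \<psi> \<chi> \<in> subformulas \<phi>} \<rparr>"

end

theory Submission
  imports Defs
begin

text \<open>Locations occurring in the transition formula of \<open>\<psi>\<close> are subformulas of \<open>\<psi>\<close>, so the
  automaton is weakly ordered. For simplicity, let \<open>q\<close> be an until location and replace \<open>q\<close> by a
  model \<open>Y\<close> of its transition formula. In a transition formula, \<open>q\<close> can only be contributed by \<open>q\<close>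
  itself or by the operand of a next formula, and the latter is excluded by hypothesis. Hence by
  structural induction the only critical formula is \<open>q\<close>, for which \<open>Y\<close> suffices by monotonicity.\<close>

lemma finite_subformulas: "finite (subformulas \<phi>)"
  by (induction \<phi>) auto

lemma subformulas_refl [simp]: "\<phi> \<in> subformulas \<phi>"
  by (cases \<phi>) auto

lemma subformulas_trans: "\<psi> \<in> subformulas \<phi> \<Longrightarrow> \<chi> \<in> subformulas \<psi> \<Longrightarrow> \<chi> \<in> subformulas \<phi>"
  by (induction \<phi>) auto

text \<open>Supplies the measure for antisymmetry: two distinct formulas cannot each be smaller than
  the other.\<close>

lemma size_subformulas: "\<psi> \<in> subformulas \<phi> \<Longrightarrow> \<psi> = \<phi> \<or> size \<psi> < size \<phi>"
  by (induction \<phi>) auto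

lemma subformulas_antisym:
  "\<psi> \<in> subformulas \<phi> \<Longrightarrow> \<phi> \<in> subformulas \<psi> \<Longrightarrow> \<psi> = \<phi>"
  using size_subformulas[of \<psi> \<phi>] size_subformulas[of \<phi> \<psi>] by auto

lemma ltl_atoms_subformulas: "\<psi> \<in> subformulas \<phi> \<Longrightarrow> ltl_atoms \<psi> \<subseteq> ltl_atoms \<phi>"
  by (induction \<phi>) auto

lemma set_ltl_delta: "set_pform (ltl_delta \<psi>) \<subseteq> subformulas \<psi> <+> ltl_atoms \<psi>"
  by (induction \<psi>) auto

lemma locations_positive: "Inl q \<notin> occurrences False (ltl_delta \<psi>)"
  by (induction \<psi>) auto

text \<open>Negation is applied only to propositions, whose valuation \<open>s\<close> stays
  fixed.\<close>

lemma ltl_delta_mono: "X <+> s \<Turnstile> ltl_delta \<psi> \<Longrightarrow> X \<subseteq> Y \<Longrightarrow> Y <+> s \<Turnstile> ltl_delta \<psi>"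
  by (induction \<psi>) auto

text \<open>Each edge leads to a subformula of its source, so the location order inherits
  antisymmetry from the subformula relation.\<close>

lemma edges_subformulas:
  "(\<psi>, \<chi>) \<in> (edges (ltl_automaton \<phi>))\<^sup>* \<Longrightarrow> \<chi> \<in> subformulas \<psi>"
proof (induction rule: rtrancl_induct)
  case (step \<chi> \<chi>')
  then have "\<chi>' \<in> subformulas \<chi>"
    using set_ltl_delta[of \<chi>] by (auto simp: edges_def ltl_automaton_def)
  with step.IH show ?case by (rule subformulas_trans)
qed simp

lemma partial_order_on_loc_order_ltl:
  "partial_order_on (subformulas \<phi>) (loc_order (ltl_automaton \<phi>))"
  unfolding partial_order_on_def preorder_on_def
proof (intro conjI)
  show "antisym (loc_order (ltl_automaton \<phi>))"
    unfolding loc_order_def antisym_def using edges_subformulas subformulas_antisym by fast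
  show "trans (loc_order (ltl_automaton \<phi>))"
    unfolding loc_order_def trans_def using rtrancl_trans by fast
qed (auto intro: refl_onI simp: loc_order_def ltl_automaton_def)

lemma lwaa_ltl_automaton:
  assumes "ltl_atoms \<phi> \<subseteq> V"
  shows "lwaa V (ltl_automaton \<phi>)"
proof -
  have "set_pform (ltl_delta \<psi>) \<subseteq> subformulas \<phi> <+> V" if "\<psi> \<in> subformulas \<phi>" for \<psi>
    using set_ltl_delta[of \<psi>] subformulas_trans[OF that] ltl_atoms_subformulas[OF that] assms
    by blast
  then show ?thesis
    using partial_order_on_loc_order_ltl[of \<phi>] finite_subformulas[of \<phi>] locations_positive
    by (auto simp: lwaa_def alternating_automaton_def to_alt_def ltl_automaton_def)
qed

lemma ltl_delta_replace_until:
  assumes "Y <+> s \<Turnstile> ltl_delta (Until \<alpha> \<beta>)"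
    and "(X \<union> {Until \<alpha> \<beta>}) <+> s \<Turnstile> ltl_delta \<psi>"
    and "Next (Until \<alpha> \<beta>) \<notin> subformulas \<psi>"
  shows "(X \<union> Y) <+> s \<Turnstile> ltl_delta \<psi>"
  using assms(2,3)
proof (induction \<psi>)
  case (Until \<psi> \<chi>)
  show ?case
  proof (cases "Until \<psi> \<chi> = Until \<alpha> \<beta>")
    case True
    with assms(1) show ?thesis
      by (metis ltl_delta_mono sup_ge2)
  next
    case False
    \<comment> \<open>The location \<open>Until \<psi> \<chi>\<close> is not the replaced one, so if
      it was available it lies in \<open>X\<close>; the operands are covered by the induction
      hypotheses.\<close>
    with Until show ?thesis by auto
  qed
\<comment> \<open>For \<open>Next\<close>, the hypothesis keeps the operand distinct from
  \<open>Until \<alpha> \<beta>\<close>; for \<open>Release\<close>, the location is not an until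
  formula. Either atom, if true, therefore comes from \<open>X\<close>.\<close>
qed auto

theorem theorem3:
  fixes V :: "'v set" and \<phi> :: "'v ltl"
  assumes "finite V"
    and "ltl_atoms \<phi> \<subseteq> V"
    and "\<not> (\<exists>\<chi> \<chi>'. Next (Until \<chi> \<chi>') \<in> subformulas \<phi>)"
  shows "simple_lwaa V (ltl_automaton \<phi>)"
proof -
  have "(X \<union> Y) <+> s \<Turnstile> ltl_delta \<psi>"
    if "\<psi> \<in> subformulas \<phi>" "(X \<union> {Until \<alpha> \<beta>}) <+> s \<Turnstile> ltl_delta \<psi>"
      "Y <+> s \<Turnstile> ltl_delta (Until \<alpha> \<beta>)" for \<psi> \<alpha> \<beta> X Y s
    using ltl_delta_replace_until[OF that(3,2)] subformulas_trans[OF that(1)] assms(3) by blast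
  then show ?thesis
    unfolding simple_lwaa_def
    \<comment> \<open>\<open>ltl_delta\<close> stays folded so that the goal matches the fact just
      shown.\<close>
    by (intro conjI lwaa_ltl_automaton assms(2)) (auto simp: ltl_automaton_def simp del: ltl_delta.simps)
qed

end
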